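(* Let $g:\mathbb{R}\to\mathbb{R}$ be a continuously differentiable function. For every $\eta>0$, $M>1$, and $\varepsilon>0$ there exist $\alpha\in(0,1)$ and $\delta>0$ such that the following holds. For every closed, finite-length interval $I$ such that (i) throughout $I$ the function $g$ is either monotone increasing or monotone decreasing, and either convex or concave, (ii) the set $\{u\in I: g(u)=0\}$ is nonempty, and (iii) $|g'|_{I,\min}>\eta$ and $\dfrac{|g'|_{I,\max}}{|g'|_{I,\min}}<M$; and for every sequence $\{u_n\}_{n=1}^{\infty}$ computed by a recursive application of $$u_{n}=u_{n-1}-\frac{1}{g'(u_{n-1})+\phi_{n-1}}\big(g(u_{n-1})+\psi_{n-1}\big)$$ (with real error terms $\phi_{n-1},\psi_{n-1}$) such that, for every $n=1,2,\ldots$, (a) $u_n\in I$, (b) $\mathcal{E}_n<\alpha$, and (c) $|\psi_n|<\delta$, the following two inequalities hold: $$\limsup_{n\to\infty}|g(u_n)|<\varepsilon\qquad\text{and}\qquad \limsup_{n\to\infty}|g(u_n)+\psi_n|<\varepsilon.$$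
   Context: For a closed interval $I=[a,b]\subset\mathbb{R}$, $|g'|_{I,\min}:=\min\{|g'(u)|:u\in I\}$ and $|g'|_{I,\max}:=\max\{|g'(u)|:u\in I\}$. The recursion is a Newton-Raphson iteration for $g(u)=0$ in which $\psi_{n-1}$ and $\phi_{n-1}$ are additive errors in the computation of $g(u_{n-1})$ and $g'(u_{n-1})$, respectively. The relative error of the derivative is $$\mathcal{E}_{n}:=\frac{|\phi_{n}|}{|g'(u_{n})|}.$$ *)

theory Defs
  imports "HOL-Analysis.Analysis"
begin

text \<open>Minimum and maximum of \<open>\<bar>g'\<bar>\<close> over a set. \<open>LEAST\<close> and \<open>GREATEST\<close> denote an attained
  minimum and maximum; they are meaningful for continuous \<open>g'\<close> on a nonempty compact \<open>I\<close>.\<close>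

definition abs_deriv_min :: "(real \<Rightarrow> real) \<Rightarrow> real set \<Rightarrow> real" where
  "abs_deriv_min g I = (LEAST m. m \<in> (\<lambda>u. \<bar>deriv g u\<bar>) ` I)"

definition abs_deriv_max :: "(real \<Rightarrow> real) \<Rightarrow> real set \<Rightarrow> real" where
  "abs_deriv_max g I = (GREATEST m. m \<in> (\<lambda>u. \<bar>deriv g u\<bar>) ` I)"

text \<open>Sequences are indexed from 1: \<open>u 1\<close> is the starting point, \<open>u 2\<close> the first computed
  iterate, and the values at index 0 play no role.\<close>

definition perturbed_newton ::
  "(real \<Rightarrow> real) \<Rightarrow> (nat \<Rightarrow> real) \<Rightarrow> (nat \<Rightarrow> real) \<Rightarrow> (nat \<Rightarrow> real) \<Rightarrow> bool" where
  "perturbed_newton g \<phi> \<psi> u \<longleftrightarrow>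
     (\<forall>n\<ge>2. u n = u (n - 1)
        - 1 / (deriv g (u (n - 1)) + \<phi> (n - 1)) * (g (u (n - 1)) + \<psi> (n - 1)))"

definition rel_deriv_error ::
  "(real \<Rightarrow> real) \<Rightarrow> (nat \<Rightarrow> real) \<Rightarrow> (nat \<Rightarrow> real) \<Rightarrow> nat \<Rightarrow> real" where
  "rel_deriv_error g \<phi> u n = \<bar>\<phi> n\<bar> / \<bar>deriv g (u n)\<bar>"

end

theory Submission
  imports Defs
begin

text \<open>
  By symmetry let \<open>g\<close> be convex on \<open>I\<close>, and put \<open>h = g (u n) + \<psi> n\<close>. By the mean value theorem
  \<open>g (u (n + 1)) = h - \<rho> h - \<psi> n\<close>, where \<open>\<rho>\<close> lies between \<open>1 / (2 M)\<close> and \<open>2 M\<close>. Hence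
  there is a contraction unless the step overshoots the root. A step from
  \<open>h < 0\<close> may overshoot by a factor up to \<open>2 M\<close>, but from \<open>h > 0\<close> the graph lies above its tangent,
  so only the error of size \<open>\<alpha>\<close> can cause an overshoot. Weighting negative values by \<open>4 M\<close>
  balances the two effects: \<open>V x = max x (- 4 M x)\<close> contracts by the factor \<open>1 - 1 / (2 M)\<close> up to an
  additive \<open>O(M \<delta>)\<close>, so that \<open>V (g (u n))\<close> is eventually \<open>O(M\<^sup>2 \<delta>)\<close>.
\<close>

section \<open>Convexity and mean values on an interval\<close>

text \<open>Along the segment from \<open>x\<close> to \<open>y\<close>, the gap \<open>p\<close>
  between chord and graph vanishes at \<open>0\<close>. If the tangent passed above
  \<open>f y\<close>, then \<open>p\<close> would have negative slope at \<open>0\<close> and be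
  negative just after it, against convexity. Parametrising by \<open>t\<close> in
  \<open>{0..1}\<close> treats both sides of \<open>x\<close> at once, and the derivative within
  \<open>S\<close> allows \<open>x\<close> to be an endpoint.\<close>

lemma convex_on_above_tangent_within:
  fixes f :: "real \<Rightarrow> real"
  assumes conv: "convex_on S f" and x: "x \<in> S" and y: "y \<in> S"
    and deriv: "(f has_real_derivative D) (at x within S)"
  shows "f x + D * (y - x) \<le> f y"
proof (rule ccontr)
  assume less: "\<not> ?thesis"
  define \<gamma> where "\<gamma> = (\<lambda>t. x + t * (y - x))"
  define p where "p = (\<lambda>t. (1 - t) * f x + t * f y - f (\<gamma> t))"
  have \<gamma>_eq: "\<gamma> t = (1 - t) *\<^sub>R x + t *\<^sub>R y" for t
    by (simp add: \<gamma>_def algebra_simps)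
  have \<gamma>_mem: "\<gamma> t \<in> S" if "t \<in> {0..1}" for t
    using convexD_alt[OF convex_on_imp_convex[OF conv] x y, of t] that by (simp add: \<gamma>_eq)
  have "((\<lambda>t. f (\<gamma> t)) has_real_derivative (y - x) * D) (at 0 within {0..1})"
  proof (rule DERIV_image_chain[of f D \<gamma> 0 "{0..1}" "y - x", unfolded o_def, simplified mult.commute[of D]])
    show "(\<gamma> has_real_derivative y - x) (at 0 within {0..1})"
      unfolding \<gamma>_def by (auto intro!: derivative_eq_intros)
    show "(f has_real_derivative D) (at (\<gamma> 0) within \<gamma> ` {0..1})"
      using \<gamma>_mem by (auto intro!: DERIV_subset[OF deriv, simplified] simp: \<gamma>_def)
  qed
  then have "(p has_real_derivative f y - f x - (y - x) * D) (at 0 within {0..1})"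
    unfolding p_def by (auto intro!: derivative_eq_intros)
  moreover have "f y - f x - (y - x) * D < 0"
    using less by (simp add: algebra_simps)
  ultimately obtain e where e: "e > 0" "\<And>t. t > 0 \<Longrightarrow> 0 + t \<in> {0..1} \<Longrightarrow> t < e \<Longrightarrow> p (0 + t) < p 0"
    by (metis has_real_derivative_neg_dec_right)
  define t where "t = min 1 (e / 2)"
  have t: "0 < t" "t \<le> 1" "t < e"
    using e(1) by (auto simp: t_def)
  have "f (\<gamma> t) \<le> (1 - t) * f x + t * f y"
    using convex_onD[OF conv, of t x y] t x y by (simp add: \<gamma>_eq)
  moreover have "p t < p 0"
    using e(2)[of t] t by simp
  ultimately show False
    by (simp add: p_def \<gamma>_def)
qed

lemma same_sign_on_connected:
  fixes f :: "'a::topological_space \<Rightarrow> real"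
  assumes "connected S" "continuous_on S f" "\<And>x. x \<in> S \<Longrightarrow> f x \<noteq> 0" "x \<in> S" "y \<in> S"
  shows "f x * f y > 0"
proof (rule ccontr)
  assume "\<not> ?thesis"
  then have "f x \<le> 0 \<and> 0 \<le> f y \<or> f y \<le> 0 \<and> 0 \<le> f x"
    by (auto simp: zero_less_mult_iff not_less)
  moreover have "connected (f ` S)"
    using assms by (simp add: connected_continuous_image)
  ultimately have "0 \<in> f ` S"
    using connectedD_interval[of "f ` S"] assms(4,5) by blast
  then show False
    using assms(3) by auto
qed

text \<open>A form of the mean value theorem for Newton steps, which may go left, go right or stay
  put, and may start or end at an endpoint of the interval. The case \<open>y < x\<close> follows by
  exchanging the two points.\<close>

lemma real_mvt_within:
  fixes f :: "real \<Rightarrow> real"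
  assumes S: "is_interval S" and x: "x \<in> S" and y: "y \<in> S"
    and deriv: "\<And>z. z \<in> S \<Longrightarrow> (f has_real_derivative f' z) (at z within S)"
  obtains z where "z \<in> S" "f y - f x = f' z * (y - x)"
proof -
  have *: "\<exists>z\<in>S. f q - f p = f' z * (q - p)" if pq: "p \<in> S" "q \<in> S" "p < q" for p q
  proof -
    have sub: "{p..q} \<subseteq> S"
      using S pq by (meson atLeastAtMost_iff mem_is_interval_1_I subsetI)
    have "\<exists>z\<in>{p<..<q}. f q - f p = (\<lambda>w. f' z * w) (q - p)"
    proof (rule mvt_simple[OF pq(3)])
      fix z assume "p \<le> z" "z \<le> q"
      then have "(f has_real_derivative f' z) (at z within {p..q})"
        using sub by (intro DERIV_subset[OF deriv]) auto
      then show "(f has_derivative (\<lambda>w. f' z * w)) (at z within {p..q})"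
        by (simp add: has_field_derivative_def)
    qed
    then show ?thesis
      using sub by force
  qed
  have "\<exists>z\<in>S. f y - f x = f' z * (y - x)"
  proof (cases x y rule: linorder_cases)
    case greater
    then obtain z where "z \<in> S" "f x - f y = f' z * (x - y)"
      using *[of y x] x y by blast
    then show ?thesis
      by (intro bexI[of _ z]) (auto simp: algebra_simps)
  qed (use * x y in auto)
  then show ?thesis
    using that by blast
qed

section \<open>Affine recursions\<close>

text \<open>The number \<open>d / (1 - c)\<close> is the fixed point of the map \<open>t\<close> to
  \<open>c * t + d\<close>. The excess of \<open>V\<close> over it is at most a geometric sequence
  tending to 0, so any level strictly above it is eventually respected.\<close>

lemma eventually_le_of_affine_recursion:
  fixes V :: "nat \<Rightarrow> real"
  assumes c: "0 \<le> c" "c < 1" and rec: "\<And>n. n \<ge> 1 \<Longrightarrow> V (Suc n) \<le> c * V n + d"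
    and L: "L > d / (1 - c)"
  shows "eventually (\<lambda>n. V n \<le> L) sequentially"
proof -
  define A where "A = d / (1 - c)"
  have A: "d = A - c * A"
    using c by (simp add: A_def divide_simps) (simp add: algebra_simps)
  \<comment> \<open>The index is shifted because the recursion starts at 1 and says nothing about
    \<open>V 0\<close>.\<close>
  have bound: "V (Suc n) - A \<le> c ^ n * (V 1 - A)" for n
  proof (induction n)
    case (Suc n)
    have "V (Suc (Suc n)) - A \<le> c * (V (Suc n) - A)"
      using rec[of "Suc n"] A by (simp add: algebra_simps)
    also have "\<dots> \<le> c * (c ^ n * (V 1 - A))"
      using Suc c by (intro mult_left_mono)
    finally show ?case
      by simp
  qed simp
  have "(\<lambda>n. c ^ n * (V 1 - A)) \<longlonglongrightarrow> 0"
    using c by (intro tendsto_mult_left_zero LIMSEQ_realpow_zero)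
  then have "eventually (\<lambda>n. c ^ n * (V 1 - A) < L - A) sequentially"
    using L by (intro order_tendstoD) (auto simp: A_def)
  then have "eventually (\<lambda>n. V (Suc n) \<le> L) sequentially"
  proof eventually_elim
    case (elim n)
    then show ?case using bound[of n] by linarith
  qed
  then show ?thesis
    by (rule eventually_sequentially_Suc[THEN iffD1])
qed

section \<open>Contraction in one perturbed Newton step\<close>

text \<open>Both entries of the maximum \<open>V z\<close> are bounded separately. Landing on the
  same side as \<open>h\<close> costs the factor \<open>1 - 1 / (2 * M)\<close> directly. An
  overshoot from \<open>h \<ge> 0\<close> is at most \<open>h / (8 * M)\<close>, which the weight
  \<open>4 * M\<close> turns into \<open>h / 2\<close>. An overshoot from \<open>h < 0\<close> is at
  most \<open>2 * M * (- h)\<close>, which is half of \<open>V h\<close>. Since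
  \<open>M > 1\<close>, the factor \<open>1 / 2\<close> is below
  \<open>1 - 1 / (2 * M)\<close>.\<close>

lemma weighted_contraction:
  fixes M r q h z :: real
  defines "V \<equiv> \<lambda>x. max x (- (4 * M) * x)"
  assumes M: "M > 1" and r: "1 / (2 * M) \<le> r" "r \<le> 2 * M"
    and q: "q \<le> 1 + 1 / (8 * M)"
    and tangent: "z \<ge> h - q * h" and z: "z = h - r * h"
  shows "V z \<le> (1 - 1 / (2 * M)) * V h"
proof (cases "h \<ge> 0")
  case True
  have "1 / (2 * M) * h \<le> r * h" "q * h \<le> (1 + 1 / (8 * M)) * h"
    using r(1) q True by (simp_all only: mult_right_mono)
  then have "z \<le> (1 - 1 / (2 * M)) * h" "- z \<le> 1 / (8 * M) * h"
    using tangent z by (simp_all add: algebra_simps)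
  moreover from this(2) have "- (4 * M) * z \<le> 1 / 2 * h"
    using M by (simp add: field_simps)
  moreover have "1 / 2 * h \<le> (1 - 1 / (2 * M)) * h"
    using True M by (intro mult_right_mono) (auto simp: field_simps)
  moreover have "V h = h"
    using True M by (auto simp: V_def max_def mult_le_0_iff intro: order_trans[of _ 0])
      (smt (verit) mult_nonneg_nonneg)
  ultimately show ?thesis
    by (auto simp: V_def)
next
  case False
  then have h: "h < 0" by simp
  have "1 / (2 * M) * (- h) \<le> r * (- h)" "r * (- h) \<le> (2 * M) * (- h)"
    using r h by (simp_all only: mult_right_mono)
  then have "- z \<le> - h - 1 / (2 * M) * (- h)" "z \<le> (2 * M) * (- h)"
    using z h by linarith+
  then have "- z \<le> (1 - 1 / (2 * M)) * (- h)" "z \<le> (2 * M) * (- h)"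
    by (simp_all add: algebra_simps)
  moreover from this(1) have "(4 * M) * (- z) \<le> (4 * M) * ((1 - 1 / (2 * M)) * (- h))"
    using M by (intro mult_left_mono) auto
  moreover have "1 / 2 * (4 * M * (- h)) \<le> (1 - 1 / (2 * M)) * (4 * M * (- h))"
    using h M by (intro mult_right_mono) (auto simp: field_simps mult_nonneg_nonpos)
  moreover have "4 * M * (- h) \<ge> 0"
    using h M by (intro mult_nonneg_nonneg) auto
  then have "V h = 4 * M * (- h)"
    using h by (auto simp: V_def)
  ultimately show ?thesis
    by (auto simp: V_def algebra_simps)
qed

lemma perturbed_newton_convex_step:
  fixes g g' :: "real \<Rightarrow> real" and I :: "real set" and M \<phi> \<psi> x y \<delta> :: real
  defines "V \<equiv> \<lambda>x. max x (- (4 * M) * x)"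
  assumes I: "is_interval I"
    and deriv: "\<And>z. z \<in> I \<Longrightarrow> (g has_real_derivative g' z) (at z within I)"
    and cont: "continuous_on I g'"
    and nz: "\<And>z. z \<in> I \<Longrightarrow> g' z \<noteq> 0"
    and ratio: "\<And>v w. v \<in> I \<Longrightarrow> w \<in> I \<Longrightarrow> \<bar>g' v\<bar> \<le> M * \<bar>g' w\<bar>"
    and conv: "convex_on I g" and M: "M > 1"
    and x: "x \<in> I" and y: "y \<in> I"
    and step: "y = x - (g x + \<psi>) / (g' x + \<phi>)"
    and \<phi>: "\<bar>\<phi>\<bar> \<le> 1 / (16 * M) * \<bar>g' x\<bar>" and \<psi>: "\<bar>\<psi>\<bar> \<le> \<delta>"
  shows "V (g y) \<le> (1 - 1 / (2 * M)) * V (g x) + 8 * M * \<delta>"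
proof -
  \<comment> \<open>\<open>\<theta>\<close> is the signed relative error of the derivative, and
    \<open>q\<close> equals \<open>g' x / (g' x + \<phi>)\<close>, the factor by which this error
    rescales the Newton step.\<close>
  define \<theta> where "\<theta> = \<phi> / g' x"
  define q where "q = 1 / (1 + \<theta>)"
  define h where "h = g x + \<psi>"
  have gx: "g' x \<noteq> 0"
    using nz x by blast
  have "\<bar>\<theta>\<bar> \<le> 1 / (16 * M)"
    using \<phi> gx by (simp add: \<theta>_def abs_divide pos_divide_le_eq)
  moreover have M16: "1 / (16 * M) < 1 / 2"
    using M by (simp add: field_simps)
  ultimately have \<theta>: "\<bar>\<theta>\<bar> \<le> 1 / (16 * M)" "\<bar>\<theta>\<bar> < 1 / 2"
    by auto
  have q: "1 / 2 \<le> q" "q \<le> 2" "q \<le> 1 + 1 / (8 * M)"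
  proof -
    show "1 / 2 \<le> q" "q \<le> 2"
      using \<theta>(2) by (auto simp: q_def field_simps)
    \<comment> \<open>This identity bounds \<open>q - 1\<close> by
      \<open>\<bar>\<theta>\<bar> * q\<close>, hence by twice \<open>1 / (16 * M)\<close>; this is
      where the tolerance 16 becomes the 8 in the overshoot bound.\<close>
    have "q = 1 - \<theta> * q"
      using \<theta>(2) by (simp add: q_def field_simps)
    also have "- \<theta> * q \<le> 1 / (16 * M) * 2"
      using \<theta> \<open>1 / 2 \<le> q\<close> \<open>q \<le> 2\<close> M by (intro mult_mono) auto
    then have "1 - \<theta> * q \<le> 1 + 1 / (8 * M)"
      by simp
    finally show "q \<le> 1 + 1 / (8 * M)" .
  qed
  have yx: "g' x * (y - x) = - (q * h)"
  proof -
    have "g' x + \<phi> = g' x * (1 + \<theta>)"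
      using gx by (simp add: \<theta>_def field_simps)
    then show ?thesis
      using gx \<theta>(2) by (simp add: step q_def h_def)
  qed
  obtain w where w: "w \<in> I" "g y - g x = g' w * (y - x)"
    using real_mvt_within[OF I x y deriv] by blast
  define \<rho> where "\<rho> = g' w / g' x"
  \<comment> \<open>A continuous nonvanishing derivative keeps its sign on an interval, so the slope
    ratio \<open>\<rho>\<close> is positive and lies between \<open>1 / M\<close> and
    \<open>M\<close>.\<close>
  have "g' w * g' x > 0"
    using same_sign_on_connected[OF _ cont nz w(1) x] I by (simp add: is_interval_connected_1)
  then have "\<rho> > 0"
    by (auto simp: \<rho>_def zero_less_mult_iff zero_less_divide_iff)
  moreover have "\<bar>\<rho>\<bar> \<le> M" "1 / M \<le> \<bar>\<rho>\<bar>"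
    using ratio[OF w(1) x] ratio[OF x w(1)] gx M
    by (auto simp: \<rho>_def abs_divide field_simps)
  ultimately have \<rho>: "1 / M \<le> \<rho>" "\<rho> \<le> M" "\<rho> > 0"
    by auto
  define z where "z = g y + \<psi>"
  have "g' w * (y - x) = \<rho> * (g' x * (y - x))"
    using gx by (simp add: \<rho>_def)
  then have z_eq: "z = h - (\<rho> * q) * h"
    using w(2) yx by (simp add: z_def h_def)
  have "1 / M * (1 / 2) \<le> \<rho> * q" "\<rho> * q \<le> M * 2"
    by (intro mult_mono; use \<rho> q M in simp)+
  then have rq: "1 / (2 * M) \<le> \<rho> * q" "\<rho> * q \<le> 2 * M"
    by (simp_all add: mult.commute)
  have "z \<ge> h - q * h"
    using convex_on_above_tangent_within[OF conv x y deriv[OF x]] yx by (simp add: z_def h_def)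
  from weighted_contraction[OF M rq q(3) this z_eq]
  have Vz: "V z \<le> (1 - 1 / (2 * M)) * V h"
    by (simp add: V_def)
  \<comment> \<open>\<open>V\<close> is Lipschitz with constant \<open>4 * M\<close>, its steeper
    slope. This is applied twice, from \<open>g x\<close> to \<open>h\<close> and from
    \<open>z\<close> back to \<open>g y\<close>, whence the total
    \<open>8 * M * \<delta>\<close>.\<close>
  have shift: "V (s + t) \<le> V s + 4 * M * \<delta>" if "\<bar>t\<bar> \<le> \<delta>" for s t
  proof -
    have "4 * M * \<bar>t\<bar> \<le> 4 * M * \<delta>" "1 * \<bar>t\<bar> \<le> 4 * M * \<bar>t\<bar>"
      using that M by (intro mult_left_mono mult_right_mono; simp)+
    moreover have "- (4 * M) * t \<le> 4 * M * \<bar>t\<bar>"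
      using mult_left_mono[of "- t" "\<bar>t\<bar>" "4 * M"] M by simp
    ultimately show ?thesis
      by (auto simp: V_def algebra_simps)
  qed
  have "V (g y) \<le> V z + 4 * M * \<delta>"
    using shift[of "- \<psi>" z] \<psi> by (simp add: z_def)
  also have "V z \<le> (1 - 1 / (2 * M)) * V h"
    by (fact Vz)
  also have "\<dots> \<le> (1 - 1 / (2 * M)) * (V (g x) + 4 * M * \<delta>)"
    using shift[OF \<psi>, of "g x"] M by (intro mult_left_mono) (auto simp: h_def)
  \<comment> \<open>The bound on \<open>\<psi>\<close> forces \<open>\<delta> \<ge> 0\<close>, so
    the contraction factor in front of \<open>4 * M * \<delta>\<close> may be dropped.\<close>
  also have "\<dots> \<le> (1 - 1 / (2 * M)) * V (g x) + 4 * M * \<delta>"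
    using M \<psi> by (simp add: algebra_simps)
  finally show ?thesis
    by simp
qed

section \<open>Asymptotic bound along the sequence\<close>

text \<open>The one-step estimate is an affine recursion for \<open>V (g (u n))\<close>. Its
  eventual bound passes to \<open>\<bar>g (u n)\<bar>\<close> because both slopes of
  \<open>V\<close> have size at least 1.\<close>

lemma perturbed_newton_convex_eventually:
  fixes g g' :: "real \<Rightarrow> real" and I :: "real set" and u \<phi> \<psi> :: "nat \<Rightarrow> real"
  assumes I: "is_interval I"
    and deriv: "\<And>z. z \<in> I \<Longrightarrow> (g has_real_derivative g' z) (at z within I)"
    and cont: "continuous_on I g'"
    and nz: "\<And>z. z \<in> I \<Longrightarrow> g' z \<noteq> 0"
    and ratio: "\<And>v w. v \<in> I \<Longrightarrow> w \<in> I \<Longrightarrow> \<bar>g' v\<bar> \<le> M * \<bar>g' w\<bar>"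
    and conv: "convex_on I g" and M: "M > 1" and \<delta>: "\<delta> > 0"
    and u: "\<And>n. n \<ge> 1 \<Longrightarrow> u n \<in> I"
    and step: "\<And>n. n \<ge> 1 \<Longrightarrow> u (Suc n) = u n - (g (u n) + \<psi> n) / (g' (u n) + \<phi> n)"
    and \<phi>: "\<And>n. n \<ge> 1 \<Longrightarrow> \<bar>\<phi> n\<bar> \<le> 1 / (16 * M) * \<bar>g' (u n)\<bar>"
    and \<psi>: "\<And>n. n \<ge> 1 \<Longrightarrow> \<bar>\<psi> n\<bar> \<le> \<delta>"
  shows "eventually (\<lambda>n. \<bar>g (u n)\<bar> \<le> 17 * M\<^sup>2 * \<delta>) sequentially"
proof -
  define V where "V = (\<lambda>x. max x (- (4 * M) * x))"
  have "eventually (\<lambda>n. V (g (u n)) \<le> 17 * M\<^sup>2 * \<delta>) sequentially"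
  proof (rule eventually_le_of_affine_recursion)
    show "0 \<le> 1 - 1 / (2 * M)" "1 - 1 / (2 * M) < 1"
      using M by (auto simp: field_simps)
    show "V (g (u (Suc n))) \<le> (1 - 1 / (2 * M)) * V (g (u n)) + 8 * M * \<delta>" if "n \<ge> 1" for n
      unfolding V_def
      using perturbed_newton_convex_step[OF I deriv cont nz ratio conv M u u step \<phi> \<psi>] that
      by simp
    \<comment> \<open>The fixed point is exactly \<open>16 * M\<^sup>2 * \<delta>\<close>; 17 leaves
      the strict room required.\<close>
    show "8 * M * \<delta> / (1 - (1 - 1 / (2 * M))) < 17 * M\<^sup>2 * \<delta>"
      using M \<delta> by (simp add: power2_eq_square)
  qed
  moreover have "\<bar>s\<bar> \<le> V s" for s
    using mult_right_mono[of 1 "4 * M" "\<bar>s\<bar>"] M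
    by (cases "s \<ge> 0") (auto simp: V_def le_max_iff_disj)
  ultimately show ?thesis
    by (auto elim!: eventually_mono intro: order_trans)
qed

text \<open>Negating \<open>g\<close>, \<open>\<phi>\<close> and \<open>\<psi>\<close> together
  leaves the iterates unchanged, since numerator and denominator of the step both change sign. This
  reduces the concave case to the convex one.\<close>

lemma perturbed_newton_eventually:
  fixes g g' :: "real \<Rightarrow> real" and I :: "real set" and u \<phi> \<psi> :: "nat \<Rightarrow> real"
  assumes I: "is_interval I"
    and deriv: "\<And>z. z \<in> I \<Longrightarrow> (g has_real_derivative g' z) (at z within I)"
    and cont: "continuous_on I g'"
    and nz: "\<And>z. z \<in> I \<Longrightarrow> g' z \<noteq> 0"
    and ratio: "\<And>v w. v \<in> I \<Longrightarrow> w \<in> I \<Longrightarrow> \<bar>g' v\<bar> \<le> M * \<bar>g' w\<bar>"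
    and conv: "convex_on I g \<or> concave_on I g" and M: "M > 1" and \<delta>: "\<delta> > 0"
    and u: "\<And>n. n \<ge> 1 \<Longrightarrow> u n \<in> I"
    and step: "\<And>n. n \<ge> 1 \<Longrightarrow> u (Suc n) = u n - (g (u n) + \<psi> n) / (g' (u n) + \<phi> n)"
    and \<phi>: "\<And>n. n \<ge> 1 \<Longrightarrow> \<bar>\<phi> n\<bar> \<le> 1 / (16 * M) * \<bar>g' (u n)\<bar>"
    and \<psi>: "\<And>n. n \<ge> 1 \<Longrightarrow> \<bar>\<psi> n\<bar> \<le> \<delta>"
  shows "eventually (\<lambda>n. \<bar>g (u n)\<bar> \<le> 17 * M\<^sup>2 * \<delta>) sequentially"
  using conv
proof
  assume "convex_on I g"
  then show ?thesis
    using perturbed_newton_convex_eventually[where g = g and g' = g' and \<phi> = \<phi> and \<psi> = \<psi>,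
        OF I deriv cont nz ratio _ M \<delta> u step \<phi> \<psi>]
    by simp
next
  assume "concave_on I g"
  then have neg: "convex_on I (\<lambda>x. - g x)"
    by (simp add: concave_on_def)
  have step': "u (Suc n) = u n - (- g (u n) + - \<psi> n) / (- g' (u n) + - \<phi> n)" if "n \<ge> 1" for n
    using step[OF that] minus_divide_divide[of "g (u n) + \<psi> n" "g' (u n) + \<phi> n"] by simp
  have "eventually (\<lambda>n. \<bar>- g (u n)\<bar> \<le> 17 * M\<^sup>2 * \<delta>) sequentially"
    by (rule perturbed_newton_convex_eventually[where g' = "\<lambda>x. - g' x" and u = u
          and \<phi> = "\<lambda>n. - \<phi> n" and \<psi> = "\<lambda>n. - \<psi> n", OF I _ _ _ _ neg M \<delta> u step'])
      (use deriv cont nz ratio \<phi> \<psi> in \<open>auto intro: DERIV_minus continuous_on_minus\<close>)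
  then show ?thesis
    by simp
qed

section \<open>Extrema of the derivative and passage to the limsup\<close>

text \<open>By compactness the extreme values are attained, so \<open>LEAST\<close> and
  \<open>GREATEST\<close> denote actual values of \<open>\<bar>deriv g\<bar>\<close> and not
  unspecified reals.\<close>

lemma abs_deriv_min_max_bounds:
  assumes "compact I" "continuous_on I (deriv g)" "x \<in> I"
  shows "abs_deriv_min g I \<le> \<bar>deriv g x\<bar>" "\<bar>deriv g x\<bar> \<le> abs_deriv_max g I"
proof -
  let ?f = "\<lambda>u. \<bar>deriv g u\<bar>"
  have f: "continuous_on I ?f" and "I \<noteq> {}"
    using assms by (auto intro: continuous_on_rabs)
  obtain p where p: "p \<in> I" "\<And>v. v \<in> I \<Longrightarrow> ?f p \<le> ?f v"
    using continuous_attains_inf[OF assms(1) \<open>I \<noteq> {}\<close> f] by blast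
  obtain q where q: "q \<in> I" "\<And>v. v \<in> I \<Longrightarrow> ?f v \<le> ?f q"
    using continuous_attains_sup[OF assms(1) \<open>I \<noteq> {}\<close> f] by blast
  have "abs_deriv_min g I = ?f p"
    unfolding abs_deriv_min_def by (rule Least_equality) (use p in auto)
  then show "abs_deriv_min g I \<le> ?f x"
    using p(2) assms(3) by simp
  have "abs_deriv_max g I = ?f q"
    unfolding abs_deriv_max_def by (rule Greatest_equality) (use q in auto)
  then show "?f x \<le> abs_deriv_max g I"
    using q(2) assms(3) by simp
qed

lemma limsup_ereal_less:
  assumes "eventually (\<lambda>n. f n \<le> c) sequentially" "c < e"
  shows "limsup (\<lambda>n. ereal (f n)) < ereal e"
proof -
  have "limsup (\<lambda>n. ereal (f n)) \<le> ereal c"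
    using assms(1) by (intro Limsup_bounded) simp
  also have "\<dots> < ereal e"
    using assms(2) by simp
  finally show ?thesis .
qed

theorem proposition2p3:
  fixes g :: "real \<Rightarrow> real"
  assumes "g C1_differentiable_on UNIV"
  shows "\<forall>\<eta>>0. \<forall>M>1. \<forall>\<epsilon>>0. \<exists>\<alpha>\<in>{0<..<1}. \<exists>\<delta>>0.
    \<forall>a b :: real. \<forall>I. a \<le> b \<longrightarrow> I = {a..b} \<longrightarrow>
      (mono_on I g \<or> antimono_on I g) \<longrightarrow>
      (convex_on I g \<or> concave_on I g) \<longrightarrow>
      {u \<in> I. g u = 0} \<noteq> {} \<longrightarrow>
      abs_deriv_min g I > \<eta> \<longrightarrow>
      abs_deriv_max g I / abs_deriv_min g I < M \<longrightarrow>
      (\<forall>u \<phi> \<psi> :: nat \<Rightarrow> real.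
         perturbed_newton g \<phi> \<psi> u \<longrightarrow>
         (\<forall>n\<ge>1. u n \<in> I \<and> rel_deriv_error g \<phi> u n < \<alpha> \<and> \<bar>\<psi> n\<bar> < \<delta>) \<longrightarrow>
         limsup (\<lambda>n. ereal \<bar>g (u n)\<bar>) < ereal \<epsilon> \<and>
         limsup (\<lambda>n. ereal \<bar>g (u n) + \<psi> n\<bar>) < ereal \<epsilon>)"
    (is "\<forall>\<eta>>0. \<forall>M>1. \<forall>\<epsilon>>0. ?Q \<eta> M \<epsilon>")
proof -
  have deriv: "(g has_real_derivative deriv g x) (at x)" and cont: "continuous_on UNIV (deriv g)" for x
  proof -
    obtain D where D: "\<And>x. (g has_vector_derivative D x) (at x)" "continuous_on UNIV D"
      using assms by (auto simp: C1_differentiable_on_def)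
    then have "(g has_real_derivative D x) (at x)" for x
      by (simp add: has_real_derivative_iff_has_vector_derivative)
    moreover from this have "deriv g = D"
      by (auto intro: DERIV_imp_deriv)
    ultimately show "(g has_real_derivative deriv g x) (at x)" "continuous_on UNIV (deriv g)"
      using D(2) by auto
  qed
  \<comment> \<open>The witnesses are fixed here: \<open>1 / (16 * M)\<close> is the relative error
    tolerated by the step estimate, and \<open>\<epsilon> / (19 * M\<^sup>2)\<close> makes
    \<open>\<epsilon>\<close> exceed the eventual bound \<open>17 * M\<^sup>2 * \<delta>\<close>
    plus one further \<open>\<delta>\<close> for \<open>\<psi> n\<close>.\<close>
  have main: "limsup (\<lambda>n. ereal \<bar>g (u n)\<bar>) < ereal \<epsilon> \<and> limsup (\<lambda>n. ereal \<bar>g (u n) + \<psi> n\<bar>) < ereal \<epsilon>"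
    if pos: "\<eta> > 0" "M > 1" "\<epsilon> > 0" and I: "I = {a..b}"
      and conv: "convex_on I g \<or> concave_on I g"
      and min: "abs_deriv_min g I > \<eta>" and max: "abs_deriv_max g I / abs_deriv_min g I < M"
      and newton: "perturbed_newton g \<phi> \<psi> u"
      and seq: "\<forall>n\<ge>1. u n \<in> I \<and> rel_deriv_error g \<phi> u n < 1 / (16 * M) \<and> \<bar>\<psi> n\<bar> < \<epsilon> / (19 * M\<^sup>2)"
    for \<eta> M \<epsilon> a b :: real and I and u \<phi> \<psi> :: "nat \<Rightarrow> real"
  proof -
    define \<delta> where "\<delta> = \<epsilon> / (19 * M\<^sup>2)"
    have \<delta>: "\<delta> > 0" and \<epsilon>: "\<epsilon> = 19 * M\<^sup>2 * \<delta>"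
      using pos by (auto simp: \<delta>_def)
    have contI: "continuous_on I (deriv g)"
      using cont by (rule continuous_on_subset) simp
    note bounds = abs_deriv_min_max_bounds[OF _ contI]
    have nz: "deriv g x \<noteq> 0" if "x \<in> I" for x
      using bounds(1)[OF _ that] min pos(1) I by auto
    have ratio: "\<bar>deriv g v\<bar> \<le> M * \<bar>deriv g w\<bar>" if "v \<in> I" "w \<in> I" for v w
    proof -
      have "\<bar>deriv g v\<bar> \<le> abs_deriv_max g I"
        using bounds(2)[OF _ that(1)] I by simp
      also have "\<dots> \<le> M * abs_deriv_min g I"
        using min max pos(1) by (simp add: field_simps)
      also have "\<dots> \<le> M * \<bar>deriv g w\<bar>"
        using bounds(1)[OF _ that(2)] I pos(2) by simp
      finally show ?thesis .
    qed
    have ev: "eventually (\<lambda>n. \<bar>g (u n)\<bar> \<le> 17 * M\<^sup>2 * \<delta>) sequentially"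
    proof (rule perturbed_newton_eventually[where g = g and g' = "deriv g" and I = I
          and u = u and \<phi> = \<phi> and \<psi> = \<psi>])
      show "u (Suc n) = u n - (g (u n) + \<psi> n) / (deriv g (u n) + \<phi> n)" if "n \<ge> 1" for n
        using newton[unfolded perturbed_newton_def, rule_format, of "Suc n"] that by simp
      show "\<bar>\<phi> n\<bar> \<le> 1 / (16 * M) * \<bar>deriv g (u n)\<bar>" if "n \<ge> 1" for n
      proof -
        have "\<bar>\<phi> n\<bar> / \<bar>deriv g (u n)\<bar> < 1 / (16 * M)" "deriv g (u n) \<noteq> 0"
          using seq nz that by (auto simp: rel_deriv_error_def)
        then show ?thesis
          by (simp add: pos_divide_less_eq)
      qed
      show "\<bar>\<psi> n\<bar> \<le> \<delta>" if "n \<ge> 1" for n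
        using seq that by (simp add: \<delta>_def less_imp_le)
    qed (use I contI nz ratio conv pos \<delta> seq deriv in \<open>auto intro: has_field_derivative_at_within\<close>)
    \<comment> \<open>The bound on \<open>\<psi> n\<close> is available from index 1 on
      only.\<close>
    have "eventually (\<lambda>n. n \<ge> (1::nat)) sequentially"
      by (rule eventually_ge_at_top)
    with ev have ev': "eventually (\<lambda>n. \<bar>g (u n) + \<psi> n\<bar> \<le> 17 * M\<^sup>2 * \<delta> + \<delta>) sequentially"
    proof eventually_elim
      case (elim n)
      then have "\<bar>\<psi> n\<bar> < \<delta>"
        using seq by (simp add: \<delta>_def)
      then show ?case
        using elim by linarith
    qed
    have "1 * \<delta> < M\<^sup>2 * \<delta>"
      using pos(2) \<delta> by (intro mult_strict_right_mono) (auto simp: one_less_power)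
    then have "17 * M\<^sup>2 * \<delta> < \<epsilon>" "17 * M\<^sup>2 * \<delta> + \<delta> < \<epsilon>"
      using \<delta> unfolding \<epsilon> by linarith+
    then show ?thesis
      using limsup_ereal_less[OF ev] limsup_ereal_less[OF ev'] by simp
  qed
  show ?thesis
  proof (intro allI impI)
    fix \<eta> M \<epsilon> :: real
    assume pos: "\<eta> > 0" "M > 1" "\<epsilon> > 0"
    have "0 < \<epsilon> / (19 * M\<^sup>2)" "1 / (16 * M) \<in> {0<..<1}"
      using pos by auto
    then show "?Q \<eta> M \<epsilon>"
      by (intro bexI[of _ "1 / (16 * M)"] exI[of _ "\<epsilon> / (19 * M\<^sup>2)"]
          conjI[of "0 < \<epsilon> / (19 * M\<^sup>2)"] allI impI main[OF pos]) blast+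
  qed
qed

end
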